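(* Let $0<u_z<1$ and let $\mathcal F'=\{(x,y,z)\in\mathbb R^3 : z=xy,\ 0\le x\le 1,\ 0\le y\le 1,\ 0\le z\le u_z\}$. Then the convex hull $\operatorname{conv}(\mathcal F')$ is exactly the set of $(x,y,z)\in\mathbb R^3$ satisfying the RLT constraints $$z\ge x+y-1,\qquad z\ge 0,\qquad z\le x,\qquad z\le y,$$ the bound $z\le u_z$, and the second-order cone constraint $z^2\le u_z\,xy$.
   Context: The RLT (Reformulation-Linearization Technique, or McCormick) constraints for the product $z=xy$ with $l_x\le x\le u_x$, $l_y\le y\le u_y$ are $z\ge u_yx+u_xy-u_xu_y$, $z\ge l_yx+l_xy-l_xl_y$, $z\le u_yx+l_xy-l_xu_y$, $z\le l_yx+u_xy-u_xl_y$. The claim writes them out for $l_x=l_y=0$, $u_x=u_y=1$. *)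

theory Defs
  imports "HOL-Analysis.Analysis"
begin

end

theory Submission
  imports Defs
begin

text \<open>Put \<open>u = u\<^sub>z\<close>. The right-hand side is convex and contains the set, so only the other
  inclusion matters. A point with \<open>x y < z\<close> lies on the segment from the origin to
  \<open>(z/y, z/x, z\<^sup>2/(x y))\<close>, which is on the surface, and the cone constraint says exactly that
  the height of this point is at most \<open>u\<close>. A point with \<open>z \<le> x y\<close> is, at its own height \<open>z\<close>,
  on the chord of the hyperbola \<open>a b = z\<close> in direction \<open>(1, -1)\<close>; the endpoints stay in the unit
  square because \<open>(1 - a) (1 - b) = 1 + z - x - y \<ge> 0\<close>.\<close>

text \<open>Polarized form of the cone constraint: multiplying the two hypotheses bounds
  \<open>(z * z')\<^sup>2\<close> by \<open>u\<^sup>2\<close> times the product of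
  \<open>x * y'\<close> and \<open>x' * y\<close>, and AM-GM turns that product into their
  sum.\<close>

lemma cone_cross_term:
  fixes u x x' y y' z z' :: real
  assumes "0 \<le> u" "0 \<le> x" "0 \<le> y" "0 \<le> x'" "0 \<le> y'"
    and "z\<^sup>2 \<le> u * (x * y)" "z'\<^sup>2 \<le> u * (x' * y')"
  shows "2 * (z * z') \<le> u * (x * y' + x' * y)"
proof (rule power2_le_imp_le)
  have "(2 * (z * z'))\<^sup>2 = 4 * (z\<^sup>2 * z'\<^sup>2)"
    by (simp add: power_mult_distrib)
  also have "\<dots> \<le> 4 * ((u * (x * y)) * (u * (x' * y')))"
    using assms by (intro mult_left_mono mult_mono) auto
  also have "\<dots> = u\<^sup>2 * (4 * ((x * y') * (x' * y)))"
    by (simp add: power2_eq_square)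
  also have "\<dots> \<le> u\<^sup>2 * (x * y' + x' * y)\<^sup>2"
    using zero_le_power2[of "x * y' - x' * y"]
    by (intro mult_left_mono) (auto simp: power2_eq_square algebra_simps)
  finally show "(2 * (z * z'))\<^sup>2 \<le> (u * (x * y' + x' * y))\<^sup>2"
    by (simp add: power_mult_distrib)
  show "0 \<le> u * (x * y' + x' * y)"
    using assms by simp
qed

text \<open>Both sides of the constraint are quadratic in the point. Expanding a convex combination,
  the pure terms compare by membership and the mixed term by \<open>cone_cross_term\<close>.\<close>

lemma convex_rotated_cone:
  fixes u :: real
  assumes "0 \<le> u"
  shows "convex {(x::real, y::real, z::real). 0 \<le> x \<and> 0 \<le> y \<and> z\<^sup>2 \<le> u * (x * y)}"
    (is "convex ?C")
proof (rule convexI)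
  fix P Q :: "real \<times> real \<times> real" and v w :: real
  assume vw: "0 \<le> v" "0 \<le> w" "v + w = 1" and "P \<in> ?C" "Q \<in> ?C"
  then obtain x y z x' y' z' where PQ: "P = (x, y, z)" "Q = (x', y', z')"
    and p: "0 \<le> x" "0 \<le> y" "z\<^sup>2 \<le> u * (x * y)"
    and q: "0 \<le> x'" "0 \<le> y'" "z'\<^sup>2 \<le> u * (x' * y')"
    by auto
  have "(v * z + w * z')\<^sup>2 = v\<^sup>2 * z\<^sup>2 + w\<^sup>2 * z'\<^sup>2 + (v * w) * (2 * (z * z'))"
    by (simp add: power2_eq_square algebra_simps)
  also have "\<dots> \<le> v\<^sup>2 * (u * (x * y)) + w\<^sup>2 * (u * (x' * y')) + (v * w) * (u * (x * y' + x' * y))"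
    using p q vw cone_cross_term[OF assms p(1,2) q(1,2) p(3) q(3)]
    by (intro add_mono mult_left_mono) auto
  also have "\<dots> = u * ((v * x + w * x') * (v * y + w * y'))"
    by (simp add: power2_eq_square algebra_simps)
  finally show "v *\<^sub>R P + w *\<^sub>R Q \<in> ?C"
    using p q vw by (simp add: PQ)
qed

lemma convex_rlt_polyhedron:
  "convex {(x::real, y::real, z::real).
     z \<ge> x + y - 1 \<and> z \<ge> 0 \<and> z \<le> x \<and> z \<le> y \<and> z \<le> u}"
  (is "convex ?C")
proof (rule convexI)
  fix P Q :: "real \<times> real \<times> real" and v w :: real
  assume vw: "0 \<le> v" "0 \<le> w" "v + w = 1" and "P \<in> ?C" "Q \<in> ?C"
  then obtain x y z x' y' z' where PQ: "P = (x, y, z)" "Q = (x', y', z')"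
    and p: "x + y \<le> z + 1" "0 \<le> z" "z \<le> x" "z \<le> y" "z \<le> u"
    and q: "x' + y' \<le> z' + 1" "0 \<le> z'" "z' \<le> x'" "z' \<le> y'" "z' \<le> u"
    by auto
  have "v * (x + y) + w * (x' + y') \<le> v * (z + 1) + w * (z' + 1)"
    using p q vw by (intro add_mono[OF mult_left_mono mult_left_mono]) auto
  then have "v * x + w * x' + (v * y + w * y') \<le> v * z + w * z' + 1"
    using vw by (simp add: algebra_simps)
  moreover have "v * z + w * z' \<le> u"
    using convex_bound_le[OF p(5) q(5)] vw by simp
  moreover have "0 \<le> v * z + w * z'"
    using p q vw by simp
  moreover have "v * z + w * z' \<le> v * x + w * x'" "v * z + w * z' \<le> v * y + w * y'"
    using p q vw by (intro add_mono mult_left_mono; simp)+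
  ultimately show "v *\<^sub>R P + w *\<^sub>R Q \<in> ?C"
    by (simp add: PQ)
qed

lemma hyperbola_chord:
  fixes x y z :: real
  assumes "0 \<le> x" "0 \<le> y" "0 \<le> z" "z < 1" "z \<le> x * y" "x + y - 1 \<le> z"
  obtains a b t where "a * b = z" "0 \<le> a" "a \<le> 1" "0 \<le> b" "b \<le> 1" "0 \<le> t" "t \<le> 1"
    "x = (1 - t) * a + t * b" "y = (1 - t) * b + t * a"
proof -
  \<comment> \<open>\<open>a\<close> and \<open>b\<close> will be the roots of
    \<open>s\<^sup>2 - (x + y) * s + z\<close>, and \<open>r\<close> is their difference
    \<open>b - a\<close>. The discriminant is at least \<open>(x - y)\<^sup>2\<close> because
    \<open>z \<le> x * y\<close>.\<close>
  define r where "r = sqrt ((x + y)\<^sup>2 - 4 * z)"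
  have d: "(x - y)\<^sup>2 \<le> (x + y)\<^sup>2 - 4 * z"
    using assms by (simp add: power2_eq_square algebra_simps)
  then have r2: "r\<^sup>2 = (x + y)\<^sup>2 - 4 * z"
    unfolding r_def by (intro real_sqrt_pow2) (use zero_le_power2[of "x - y"] in linarith)
  have rxy: "\<bar>x - y\<bar> \<le> r"
    unfolding r_def using d by (metis real_sqrt_abs real_sqrt_le_iff)
  have "r \<le> x + y"
    unfolding r_def using assms by (intro real_le_lsqrt) auto
  define a where "a = (x + y - r) / 2"
  define b where "b = (x + y + r) / 2"
  have ab: "a * b = z"
    using r2 by (simp add: a_def b_def power2_eq_square algebra_simps)
  have a0: "0 \<le> a" and le: "a \<le> b"
    using \<open>r \<le> x + y\<close> rxy by (auto simp: a_def b_def)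
  have sum: "a + b = x + y"
    by (simp add: a_def b_def field_simps)
  \<comment> \<open>If the larger root exceeded 1, nonnegativity of \<open>(1 - a) * (1 - b)\<close>
    would push the smaller one to at least 1 too, contradicting
    \<open>a * b = z < 1\<close>.\<close>
  have b1: "b \<le> 1"
  proof (rule ccontr)
    assume "\<not> b \<le> 1"
    moreover have "(1 - a) * (1 - b) \<ge> 0"
      using ab sum assms by (simp add: algebra_simps)
    ultimately have "a \<ge> 1"
      by (auto simp: zero_le_mult_iff)
    then have "1 * 1 \<le> a * b"
      using le by (intro mult_mono) auto
    then show False
      using ab assms by simp
  qed
  \<comment> \<open>Solves \<open>x = a + t * r\<close>. If \<open>r = 0\<close>, then
    \<open>x = y = a = b\<close>, so the value 0 is as good as any. Otherwise
    \<open>x - a = (x - y + r) / 2\<close> lies between 0 and \<open>r\<close>.\<close>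
  define t where "t = (if r = 0 then 0 else (x - a) / r)"
  have tr: "t * r = x - a"
    using rxy by (auto simp: t_def a_def)
  have "0 \<le> t" "t \<le> 1"
    using rxy by (auto simp: t_def a_def divide_simps)
  moreover have br: "b = a + r"
    by (simp add: a_def b_def field_simps)
  moreover have "x = (1 - t) * a + t * b"
    using tr br by (simp add: algebra_simps)
  moreover have "y = (1 - t) * b + t * a"
    using tr br sum by (simp add: algebra_simps)
  ultimately show thesis
    using that[of a b t] ab a0 b1 le by simp
qed

theorem proposition1:
  fixes u\<^sub>z :: real
  assumes "0 < u\<^sub>z" and "u\<^sub>z < 1"
  shows "convex hull {(x::real, y::real, z::real).
             z = x * y \<and> 0 \<le> x \<and> x \<le> 1 \<and> 0 \<le> y \<and> y \<le> 1 \<and> 0 \<le> z \<and> z \<le> u\<^sub>z}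
       = {(x::real, y::real, z::real).
             z \<ge> x + y - 1 \<and> z \<ge> 0 \<and> z \<le> x \<and> z \<le> y \<and> z \<le> u\<^sub>z \<and> z\<^sup>2 \<le> u\<^sub>z * (x * y)}"
    (is "convex hull ?F = ?R")
proof
  show "convex hull ?F \<subseteq> ?R"
  proof (rule hull_minimal)
    show "?F \<subseteq> ?R"
    proof
      fix P assume "P \<in> ?F"
      then obtain x y where P: "P = (x, y, x * y)"
        and *: "0 \<le> x" "x \<le> 1" "0 \<le> y" "y \<le> 1" "0 \<le> x * y" "x * y \<le> u\<^sub>z"
        by auto
      have "0 \<le> (1 - x) * (1 - y)"
        using * by simp
      then have "x + y \<le> x * y + 1"
        by (simp add: algebra_simps)
      moreover have "x * y \<le> x" "x * y \<le> y"
        using * by (simp_all add: mult_left_le mult_left_le_one_le)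
      moreover have "(x * y)\<^sup>2 \<le> u\<^sub>z * (x * y)"
        unfolding power2_eq_square using * by (intro mult_right_mono) auto
      ultimately show "P \<in> ?R"
        using * by (simp add: P)
    qed
    \<comment> \<open>The signs of \<open>x\<close> and \<open>y\<close> that the cone demands come
      from \<open>0 \<le> z\<close>, \<open>z \<le> x\<close> and \<open>z \<le> y\<close>.\<close>
    have "?R = {(x, y, z). z \<ge> x + y - 1 \<and> z \<ge> 0 \<and> z \<le> x \<and> z \<le> y \<and> z \<le> u\<^sub>z}
        \<inter> {(x, y, z). 0 \<le> x \<and> 0 \<le> y \<and> z\<^sup>2 \<le> u\<^sub>z * (x * y)}"
      by auto
    then show "convex ?R"
      using assms by (simp only: convex_Int convex_rlt_polyhedron convex_rotated_cone less_imp_le)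
  qed
  show "?R \<subseteq> convex hull ?F"
  proof (clarify)
    fix x y z :: real
    assume h: "x + y - 1 \<le> z" "0 \<le> z" "z \<le> x" "z \<le> y" "z \<le> u\<^sub>z" "z\<^sup>2 \<le> u\<^sub>z * (x * y)"
    have comb: "(1 - t) *\<^sub>R p + t *\<^sub>R q \<in> convex hull ?F"
      if "p \<in> ?F" "q \<in> ?F" "0 \<le> t" "t \<le> 1" for p q t
      using that by (intro convexD[OF convex_convex_hull] hull_inc) auto
    show "(x, y, z) \<in> convex hull ?F"
    proof (cases "z \<le> x * y")
      case True
      obtain a b t where ab: "a * b = z" "0 \<le> a" "a \<le> 1" "0 \<le> b" "b \<le> 1" "0 \<le> t" "t \<le> 1"
        "x = (1 - t) * a + t * b" "y = (1 - t) * b + t * a"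
        using hyperbola_chord[of x y z] h True assms by auto
      \<comment> \<open>The endpoints are mirror images under swapping the first two coordinates, so
        both lie on the surface at height \<open>z\<close>.\<close>
      have "(1 - t) *\<^sub>R (a, b, z) + t *\<^sub>R (b, a, z) \<in> convex hull ?F"
        using ab h by (intro comb) (auto simp: mult.commute)
      moreover have "(1 - t) * z + t * z = z"
        by (simp add: algebra_simps)
      ultimately show ?thesis
        using ab by simp
    next
      case False
      have "0 \<le> x * y"
        using h by simp
      then have pos: "0 < z" "0 < x" "0 < y"
        using False h by linarith+
      \<comment> \<open>The factor that scales the surface point back to \<open>(x, y, z)\<close>;
        it is below 1 exactly because \<open>x * y < z\<close>. The first two coordinates of that
        point are at most 1 by \<open>z \<le> y\<close> and \<open>z \<le> x\<close>.\<close>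
      define t where "t = x * y / z"
      have "(1 - t) *\<^sub>R (0, 0, 0) + t *\<^sub>R (z / y, z / x, z\<^sup>2 / (x * y)) \<in> convex hull ?F"
        using assms pos h False
        by (intro comb) (auto simp: t_def divide_simps power2_eq_square)
      moreover have "t * (z / y) = x" "t * (z / x) = y" "t * (z\<^sup>2 / (x * y)) = z"
        using pos by (auto simp: t_def field_simps power2_eq_square)
      ultimately show ?thesis
        by simp
    qed
  qed
qed

end
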